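(* Let $\omega(s)$ be a numerical polynomial of degree $d$ and let $b(\omega)=(b_d,\dots,b_0)\in\mathbb{Z}^{d+1}$ be the sequence of its minimizing coefficients. Put $$c_i=\sum_{j=i-1}^{d} b_j,\qquad i=1,\dots,d+1,$$ and let $c_0$ be arbitrary. Then $$\omega(s)=\binom{s+d+1}{d+1}-\sum_{i=0}^{d+1}\binom{s+i-1-c_i}{i}.$$
   Context: A numerical polynomial is a polynomial $\omega(s)$ in one variable $s$ (with rational coefficients) taking integer values at integer points. For an integer $k$ and $i\ge 0$, $\binom{s+k}{i}$ denotes the polynomial $\frac{(s+k)(s+k-1)\cdots(s+k-i+1)}{i!}$ in $s$; in particular $\binom{s+k}{0}=1$. Every numerical polynomial of degree $d$ can be written uniquely as $\omega(s)=\sum_{i=0}^{d}a_i\binom{s+i}{i}$ with $a_i\in\mathbb{Z}$; the numbers $(a_d,\dots,a_0)$ are its standard coefficients. The sequence of minimizing coefficients $b(\omega)=(b_d,\dots,b_0)\in\mathbb{Z}^{d+1}$ of a numerical polynomial $\omega$ of degree $d$ is defined by induction on $d$. If $d=0$ (i.e. $\omega$ is a constant, possibly zero), then $b(\omega)=(\omega)$. If $d>0$ and $(a_d,\dots,a_0)$ are the standard coefficients of $\omega$, put $$v(s)=\omega(s+a_d)-\binom{s+d+1+a_d}{d+1}+\binom{s+d+1}{d+1}.$$ Then $\deg v<d$; let $b(v)=(b_k,\dots,b_0)$, $0\le k<d$, be the sequence of minimizing coefficients of $v$, and define $b(\omega)=(a_d,0,\dots,0,b_k,\dots,b_0)\in\mathbb{Z}^{d+1}$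 (padded with zeros between $a_d$ and $b_k$). *)

theory Defs
  imports Complex_Main "HOL-Computational_Algebra.Polynomial"
begin

definition numerical_poly :: "rat poly \<Rightarrow> bool" where
  "numerical_poly p \<longleftrightarrow> (\<forall>n::int. poly p (of_int n) \<in> \<int>)"

text \<open>\<open>binom_poly k i\<close> is the binomial coefficient \<open>(s + k) choose i\<close>
  as a polynomial in the indeterminate \<open>s\<close>.\<close>

definition binom_poly :: "int \<Rightarrow> nat \<Rightarrow> rat poly" where
  "binom_poly k i = smult (1 / fact i) (\<Prod>j<i. [:of_int k - of_nat j, 1:])"

lemma poly_binom_poly: "poly (binom_poly k i) x = (x + of_int k) gchoose i"
  by (simp add: binom_poly_def gbinomial_prod_rev poly_prod atLeast0LessThan algebra_simps)

lemma degree_binom_poly: "degree (binom_poly k i) = i"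
proof -
  have "degree (\<Prod>j<i. [:of_int k - of_nat j, 1 :: rat:]) =
      (\<Sum>j<i. degree [:of_int k - of_nat j, 1 :: rat:])"
    by (rule degree_prod_eq_sum_degree) auto
  then show ?thesis by (simp add: binom_poly_def)
qed

lemma coeff_binom_poly_top: "coeff (binom_poly k i) i = 1 / fact i"
proof -
  have "lead_coeff (\<Prod>j<i. [:of_int k - of_nat j, 1 :: rat:]) = 1"
    by (subst lead_coeff_prod) simp
  then have "lead_coeff (binom_poly k i) = 1 / fact i"
    unfolding binom_poly_def lead_coeff_smult by simp
  then show ?thesis by (simp add: degree_binom_poly)
qed

lemma binom_poly_Suc_diff:
  "binom_poly (k + 1) (Suc i) - binom_poly k (Suc i) = binom_poly k i"
proof -
  have "poly (binom_poly (k + 1) (Suc i) - binom_poly k (Suc i)) x = poly (binom_poly k i) x" for x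
    using gbinomial_Suc_Suc[of "x + of_int k" i] by (simp add: poly_binom_poly add.assoc)
  then show ?thesis by (auto simp: poly_eq_poly_eq_iff[symmetric])
qed

lemma binom_poly_shift_diff:
  "degree (binom_poly (k + a) (Suc d) - binom_poly k (Suc d)) \<le> d \<and>
   coeff (binom_poly (k + a) (Suc d) - binom_poly k (Suc d)) d = of_int a / fact d"
proof (induction a rule: int_induct[where k = 0])
  case base
  then show ?case by simp
next
  case (step1 a)
  have "binom_poly (k + (a + 1)) (Suc d) - binom_poly k (Suc d) =
      (binom_poly (k + a) (Suc d) - binom_poly k (Suc d)) + binom_poly (k + a) d"
    using binom_poly_Suc_diff[of "k + a" d] by (simp add: algebra_simps)
  then show ?case
    using step1 by (simp only:) (auto intro!: degree_add_le
      simp: degree_binom_poly coeff_binom_poly_top add_divide_distrib)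
next
  case (step2 a)
  have "binom_poly (k + (a - 1)) (Suc d) - binom_poly k (Suc d) =
      (binom_poly (k + a) (Suc d) - binom_poly k (Suc d)) - binom_poly (k + (a - 1)) d"
    using binom_poly_Suc_diff[of "k + (a - 1)" d] by (simp add: algebra_simps)
  then show ?case
    using step2 by (simp only:) (auto intro!: degree_diff_le
      simp: degree_binom_poly coeff_binom_poly_top diff_divide_distrib)
qed

lemma numerical_binom_poly: "numerical_poly (binom_poly k i)"
  unfolding numerical_poly_def poly_binom_poly of_int_add[symmetric]
  by (simp add: of_int_gbinomial[symmetric] del: of_int_add)

lemma numerical_diff:
  "numerical_poly p \<Longrightarrow> numerical_poly q \<Longrightarrow> numerical_poly (p - q)"
  by (simp add: numerical_poly_def)

lemma numerical_add:
  "numerical_poly p \<Longrightarrow> numerical_poly q \<Longrightarrow> numerical_poly (p + q)"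
  by (simp add: numerical_poly_def)

lemma numerical_shift:
  assumes "numerical_poly p"
  shows "numerical_poly (pcompose p [:of_int k, 1:])"
  unfolding numerical_poly_def
proof
  fix n :: int
  have "poly p (of_int (k + n)) \<in> \<int>"
    using assms unfolding numerical_poly_def by blast
  then show "poly (pcompose p [:of_int k, 1:]) (of_int n) \<in> \<int>"
    by (simp add: poly_pcompose)
qed

lemma degree_shift: "degree (pcompose p [:k, 1:]) = degree p" for p :: "rat poly"
  by (simp add: degree_pcompose)

lemma coeff_shift_top:
  fixes p :: "rat poly"
  assumes "degree p \<le> d"
  shows "coeff (pcompose p [:k, 1:]) d = coeff p d"
proof (cases "degree p = d")
  case True
  then show ?thesis
    using lead_coeff_comp[of "[:k, 1:]" p] by (simp add: degree_shift)
next
  case False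
  with assms show ?thesis by (simp add: coeff_eq_0 degree_shift)
qed

lemma shift_invariant_const:
  fixes p :: "rat poly"
  assumes "\<And>x. poly p x = poly p (x - 1)"
  shows "p = [:poly p 0:]"
proof -
  have *: "poly p (of_nat n) = poly p 0" for n
  proof (induction n)
    case (Suc n)
    then show ?case using assms[of "of_nat (Suc n)"] by simp
  qed simp
  have "range (of_nat :: nat \<Rightarrow> rat) \<subseteq> {x. poly (p - [:poly p 0:]) x = 0}"
    using * by auto
  moreover have "infinite (range (of_nat :: nat \<Rightarrow> rat))"
    by (simp add: finite_image_iff inj_of_nat)
  ultimately have "p - [:poly p 0:] = 0"
    using poly_roots_finite finite_subset by blast
  then show ?thesis by simp
qed

lemma standard_coeffs_exist:
  assumes "numerical_poly p" "degree p \<le> d"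
  shows "\<exists>a. (\<forall>i>d. a i = 0) \<and>
    p = (\<Sum>i\<le>d. smult (of_int (a i)) (binom_poly (int i) i))"
  using assms
proof (induction d arbitrary: p)
  case 0
  then obtain c where c: "p = [:c:]" by (auto elim: degree_eq_zeroE)
  with 0 obtain m where "c = of_int m"
    by (auto simp: numerical_poly_def elim: Ints_cases)
  with c show ?case
    by (intro exI[of _ "\<lambda>i. if i = 0 then m else 0"]) (simp add: binom_poly_def)
next
  case (Suc d)
  define q where "q = p - pcompose p [:of_int (-1), 1:]"
  have "numerical_poly q"
    unfolding q_def using Suc.prems(1) by (intro numerical_diff numerical_shift)
  moreover have "degree q \<le> d"
  proof (rule degree_le, intro allI impI)
    fix i assume "d < i"
    then have "degree p \<le> i" using Suc.prems(2) by simp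
    then show "coeff q i = 0" by (simp add: q_def coeff_shift_top)
  qed
  ultimately obtain a where a: "\<forall>i>d. a i = 0"
    "q = (\<Sum>i\<le>d. smult (of_int (a i)) (binom_poly (int i) i))"
    using Suc.IH by blast
  define r where
    "r = p - (\<Sum>i\<le>d. smult (of_int (a i)) (binom_poly (int (Suc i)) (Suc i)))"
  have pq: "poly p x - poly p (x - 1) = poly q x" for x
    by (simp add: q_def poly_pcompose)
  have B: "((x + of_int (int (Suc i))) gchoose Suc i) - ((x - 1 + of_int (int (Suc i))) gchoose Suc i)
      = (x + of_int (int i)) gchoose i" for x :: rat and i
    using gbinomial_Suc_Suc[of "x + of_nat i" i] by (simp add: algebra_simps)
  have "poly r x - poly r (x - 1) = 0" for x
  proof -
    have "poly r x - poly r (x - 1) = poly q x -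
      (\<Sum>i\<le>d. of_int (a i) * (((x + of_int (int (Suc i))) gchoose Suc i) -
         ((x - 1 + of_int (int (Suc i))) gchoose Suc i)))"
      using pq[of x]
      by (simp add: r_def poly_sum poly_binom_poly right_diff_distrib sum_subtractf del: of_int_of_nat_eq)
    also have "\<dots> = 0"
      unfolding B a(2) by (simp add: poly_sum poly_binom_poly)
    finally show ?thesis .
  qed
  then have r: "r = [:poly r 0:]" by (intro shift_invariant_const) simp
  have "poly p 0 \<in> \<int>"
    using Suc.prems(1) unfolding numerical_poly_def by (metis of_int_0)
  moreover have "poly (binom_poly (int (Suc i)) (Suc i)) 0 \<in> \<int>" for i
    using numerical_binom_poly unfolding numerical_poly_def by (metis of_int_0)
  ultimately have "poly r 0 \<in> \<int>"
    by (auto simp: r_def poly_sum intro!: Ints_diff Ints_sum Ints_mult)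
  then obtain m where m: "poly r 0 = of_int m" by (auto elim: Ints_cases)
  define b where "b i = (case i of 0 \<Rightarrow> m | Suc j \<Rightarrow> a j)" for i
  have "p = r + (\<Sum>i\<le>d. smult (of_int (a i)) (binom_poly (int (Suc i)) (Suc i)))"
    by (simp add: r_def)
  also have "\<dots> = (\<Sum>i\<le>Suc d. smult (of_int (b i)) (binom_poly (int i) i))"
    unfolding sum.atMost_Suc_shift using r m by (simp add: b_def binom_poly_def)
  finally have "p = (\<Sum>i\<le>Suc d. smult (of_int (b i)) (binom_poly (int i) i))" .
  moreover have "\<forall>i>Suc d. b i = 0"
    using a(1) by (auto simp: b_def split: nat.split)
  ultimately show ?case by blast
qed

lemma coeff_standard_sum_top:
  "coeff (\<Sum>i\<le>d. smult (of_int (a i)) (binom_poly (int i) i)) d = of_int (a d) / fact d"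
proof -
  have "coeff (\<Sum>i\<le>d. smult (of_int (a i)) (binom_poly (int i) i)) d =
      (\<Sum>i\<le>d. if i = d then of_int (a d) / fact d else 0)"
    unfolding coeff_sum
    by (intro sum.cong) (auto simp: coeff_binom_poly_top coeff_eq_0 degree_binom_poly)
  then show ?thesis by simp
qed

lemma standard_coeffs_unique:
  assumes "(\<Sum>i\<le>d. smult (of_int (a i)) (binom_poly (int i) i)) =
           (\<Sum>i\<le>d. smult (of_int (b i)) (binom_poly (int i) i))"
    and "i \<le> d"
  shows "a i = b i"
  using assms
proof (induction d)
  case 0
  then show ?case using coeff_standard_sum_top[of a 0] coeff_standard_sum_top[of b 0] by simp
next
  case (Suc d)
  have top: "a (Suc d) = b (Suc d)"
    using coeff_standard_sum_top[of a "Suc d"] coeff_standard_sum_top[of b "Suc d"] Suc.prems(1)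
    by (simp del: sum.atMost_Suc)
  with Suc show ?case by (cases "i = Suc d") auto
qed

text \<open>The standard coefficient sequence \<open>(a\<^sub>d, \<dots>, a\<^sub>0)\<close> is represented by the function
  \<open>i \<mapsto> a\<^sub>i\<close>, extended by \<open>0\<close> to \<open>i > d\<close>.\<close>

definition standard_coeffs :: "rat poly \<Rightarrow> nat \<Rightarrow> int" where
  "standard_coeffs p = (THE a. (\<forall>i>degree p. a i = 0) \<and>
     p = (\<Sum>i\<le>degree p. smult (of_int (a i)) (binom_poly (int i) i)))"

lemma standard_coeffs:
  assumes "numerical_poly p"
  shows "\<forall>i>degree p. standard_coeffs p i = 0"
    and "p = (\<Sum>i\<le>degree p. smult (of_int (standard_coeffs p i)) (binom_poly (int i) i))"
proof -
  let ?P = "\<lambda>a. (\<forall>i>degree p. a i = 0) \<and>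
     p = (\<Sum>i\<le>degree p. smult (of_int (a i)) (binom_poly (int i) i))"
  obtain a where a: "?P a" using standard_coeffs_exist[OF assms order_refl] by blast
  have "a' = a" if a': "?P a'" for a'
  proof
    fix i
    have "(\<Sum>i\<le>degree p. smult (of_int (a' i)) (binom_poly (int i) i)) =
          (\<Sum>i\<le>degree p. smult (of_int (a i)) (binom_poly (int i) i))"
      using a a' by simp
    then show "a' i = a i"
      using standard_coeffs_unique[of a' "degree p" a i] a a'
      by (cases "i \<le> degree p") (blast, simp)
  qed
  with a have "?P (standard_coeffs p)"
    unfolding standard_coeffs_def by (rule theI)
  then show "\<forall>i>degree p. standard_coeffs p i = 0"
    and "p = (\<Sum>i\<le>degree p. smult (of_int (standard_coeffs p i)) (binom_poly (int i) i))"
    by blast+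
qed

definition min_step :: "rat poly \<Rightarrow> rat poly" where
  "min_step p = (let d = degree p; a = standard_coeffs p d in
     pcompose p [:of_int a, 1:] - binom_poly (int d + 1 + a) (d + 1) + binom_poly (int d + 1) (d + 1))"

lemma numerical_min_step: "numerical_poly p \<Longrightarrow> numerical_poly (min_step p)"
  unfolding min_step_def Let_def
  by (intro numerical_add numerical_diff numerical_shift numerical_binom_poly)

lemma degree_min_step:
  assumes "numerical_poly p" "degree p > 0"
  shows "degree (min_step p) < degree p"
proof -
  define d where "d = degree p"
  define a where "a = standard_coeffs p d"
  let ?D = "binom_poly (int d + 1 + a) (Suc d) - binom_poly (int d + 1) (Suc d)"
  have eq: "min_step p = pcompose p [:of_int a, 1:] - ?D"
    by (simp add: min_step_def Let_def d_def a_def)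
  have "coeff p d = of_int a / fact d"
    using standard_coeffs(2)[OF assms(1)] coeff_standard_sum_top[of "standard_coeffs p" d]
    by (simp add: d_def a_def)
  then have "coeff (min_step p) d = 0"
    unfolding eq using binom_poly_shift_diff[of "int d + 1" a d]
    by (simp add: coeff_shift_top d_def)
  moreover have "degree (min_step p) \<le> d"
    unfolding eq
    by (rule degree_diff_le) (simp_all add: binom_poly_shift_diff degree_shift d_def)
  ultimately show ?thesis
    using assms(2) unfolding d_def[symmetric]
    by (metis leading_coeff_0_iff degree_0 le_neq_implies_less)
qed

text \<open>The minimizing coefficient sequence \<open>(b\<^sub>d, \<dots>, b\<^sub>0)\<close> is represented by the function
  \<open>i \<mapsto> b\<^sub>i\<close>, extended by \<open>0\<close> to \<open>i > d\<close>. The guard on \<open>numerical_poly\<close> makes the recursion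
  total; it never fails in a recursive call by \<open>numerical_min_step\<close>. The floor in the base case
  only converts the integral constant to type \<open>int\<close>.\<close>

function min_coeffs :: "rat poly \<Rightarrow> nat \<Rightarrow> int" where
  "min_coeffs p =
     (if \<not> numerical_poly p then (\<lambda>i. 0)
      else if degree p = 0 then (\<lambda>i. if i = 0 then \<lfloor>coeff p 0\<rfloor> else 0)
      else (\<lambda>i. if i = degree p then standard_coeffs p (degree p)
                else if i \<le> degree (min_step p) then min_coeffs (min_step p) i
                else 0))"
  by auto
termination
  by (relation "measure degree") (auto intro: degree_min_step)

declare min_coeffs.simps [simp del]

end

theory Submission
  imports Defs
begin

text \<open>
  Write \<open>\<Phi>\<^sub>D(b)\<close> for the right-hand side of the theorem, built from a sequence \<open>b\<close> and a number
  \<open>D\<close> in place of the degree, with \<open>c\<^sub>i = b\<^sub>i\<^sub>-\<^sub>1 + \<dots> + b\<^sub>D\<close>. Passing from \<open>D\<close> to \<open>D + 1\<close> adds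
  \<open>b\<^sub>D\<^sub>+\<^sub>1\<close> to every \<open>c\<^sub>i\<close>, that is, it translates the sum in \<open>\<Phi>\<^sub>D(b)\<close> by \<open>-b\<^sub>D\<^sub>+\<^sub>1\<close>, and appends one
  summand. A single application of Pascal's rule absorbs this summand and leaves, with
  \<open>a = b\<^sub>D\<^sub>+\<^sub>1\<close>,
  \[ \Phi_{D+1}(b)(s) = \Phi_D(b)(s-a) - \binom{s+D+2-a}{D+2} + \binom{s+D+2}{D+2}. \]
  This is the rule that recovers \<open>\<omega>\<close> from \<open>v\<close> in the definition of the minimizing coefficients
  (lemmas \<open>minimizing_form_Suc\<close> and \<open>min_step_inverse\<close>), so the theorem follows by induction.

  For \<open>a = 0\<close> the two extra binomials cancel, so padding \<open>b\<close> with zeros does not change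
  \<open>\<Phi>\<^sub>D(b)\<close>. The induction can therefore run over an upper bound \<open>D\<close> of the degree, and it does not
  matter by how much the degree drops from \<open>\<omega>\<close> to \<open>v\<close>.
\<close>

section \<open>Translating polynomials\<close>

lemma pcompose_binom_poly:
  "pcompose (binom_poly k i) [:of_int a, 1:] = binom_poly (k + a) i"
proof -
  have "poly (pcompose (binom_poly k i) [:of_int a, 1:]) x = poly (binom_poly (k + a) i) x" for x
    by (simp add: poly_pcompose poly_binom_poly algebra_simps)
  then show ?thesis by (auto simp: poly_eq_poly_eq_iff[symmetric])
qed

lemma binom_poly_0 [simp]: "binom_poly k 0 = 1"
  by (simp add: binom_poly_def)

lemma pcompose_shift_inverse:
  fixes p :: "rat poly"
  shows "pcompose (pcompose p [:of_int a, 1:]) [:of_int (- a), 1:] = p"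
  by (simp flip: pcompose_assoc add: pcompose_pCons pcompose_idR)

lemma min_step_inverse:
  assumes "degree p = d" and "standard_coeffs p d = a"
  shows "p = pcompose (min_step p) [:of_int (- a), 1:]
    - binom_poly (int d + 1 - a) (d + 1) + binom_poly (int d + 1) (d + 1)"
proof -
  have "pcompose (min_step p) [:of_int (- a), 1:] =
      p - binom_poly (int d + 1) (d + 1) + binom_poly (int d + 1 - a) (d + 1)"
    unfolding min_step_def Let_def assms
    by (simp only: pcompose_add pcompose_diff pcompose_shift_inverse pcompose_binom_poly)
       (simp add: algebra_simps)
  then show ?thesis by simp
qed

section \<open>The polynomial with given minimizing coefficients\<close>

text \<open>The summand \<open>i = 0\<close> equals \<open>1\<close> whatever \<open>c\<^sub>0\<close> is; here truncated subtraction makes \<open>c\<^sub>0\<close>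
  equal to \<open>c\<^sub>1\<close>.\<close>

definition minimizing_form :: "nat \<Rightarrow> (nat \<Rightarrow> int) \<Rightarrow> rat poly" where
  "minimizing_form D b = binom_poly (int D + 1) (D + 1)
     - (\<Sum>i\<le>D + 1. binom_poly (int i - 1 - (\<Sum>j=i-1..D. b j)) i)"

lemma minimizing_form_cong:
  assumes "\<And>j. j \<le> D \<Longrightarrow> b j = b' j"
  shows "minimizing_form D b = minimizing_form D b'"
proof -
  have "(\<Sum>j=i..D. b j) = (\<Sum>j=i..D. b' j)" for i
    using assms by (intro sum.cong) auto
  then show ?thesis by (simp only: minimizing_form_def)
qed

text \<open>The translation by \<open>-a\<close> turns \<open>c\<^sub>i\<close> into \<open>c\<^sub>i + a\<close> for \<open>i \<le> D + 1\<close>. The leading binomial of the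
  translated form and the new summand \<open>i = D + 2\<close> are the two terms of Pascal's rule for
  \<open>binom_poly (D + 2 - a) (D + 2)\<close>.\<close>

lemma minimizing_form_Suc:
  assumes "b (Suc D) = a"
  shows "minimizing_form (Suc D) b = pcompose (minimizing_form D b) [:of_int (- a), 1:]
    - binom_poly (int D + 2 - a) (D + 2) + binom_poly (int D + 2) (D + 2)"
proof -
  define t where "t i = binom_poly (int i - 1 - (\<Sum>j=i-1..Suc D. b j)) i" for i
  have low: "pcompose (binom_poly (int i - 1 - (\<Sum>j=i-1..D. b j)) i) [:of_int (- a), 1:] = t i"
    if "i \<le> D + 1" for i
  proof -
    have "(\<Sum>j=i-1..Suc D. b j) = (\<Sum>j=i-1..D. b j) + a"
      using that assms by (subst sum.cl_ivl_Suc) auto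
    then show ?thesis
      by (simp only: pcompose_binom_poly t_def) (simp add: algebra_simps)
  qed
  have "pcompose (minimizing_form D b) [:of_int (- a), 1:] =
      binom_poly (int D + 1 - a) (D + 1) - (\<Sum>i\<le>D + 1. t i)"
    unfolding minimizing_form_def pcompose_diff pcompose_sum
    using low by (simp add: pcompose_binom_poly del: of_int_minus sum.atMost_Suc)
  moreover have "minimizing_form (Suc D) b =
      binom_poly (int D + 2) (D + 2) - ((\<Sum>i\<le>D + 1. t i) + t (D + 2))"
    by (simp add: minimizing_form_def t_def numeral_2_eq_2 add.commute)
  moreover have "t (D + 2) = binom_poly (int D + 1 - a) (D + 2)"
    by (simp add: t_def assms add.commute)
  moreover have "binom_poly (int D + 2 - a) (D + 2) =
      binom_poly (int D + 1 - a) (D + 2) + binom_poly (int D + 1 - a) (D + 1)"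
    using binom_poly_Suc_diff[of "int D + 1 - a" "D + 1"] by (simp add: algebra_simps)
  ultimately show ?thesis by simp
qed

section \<open>Recovering a polynomial from its minimizing coefficients\<close>

lemma min_coeffs_above_degree: "degree p < j \<Longrightarrow> min_coeffs p j = 0"
  by (subst min_coeffs.simps) (use degree_min_step[of p] in auto)

lemma min_coeffs_below_degree:
  assumes "numerical_poly p" "j < degree p"
  shows "min_coeffs p j = min_coeffs (min_step p) j"
  using assms min_coeffs_above_degree[of "min_step p" j]
  by (subst min_coeffs.simps) auto

lemma min_coeffs_degree:
  assumes "numerical_poly p" "0 < degree p"
  shows "min_coeffs p (degree p) = standard_coeffs p (degree p)"
  using assms by (subst min_coeffs.simps) auto

lemma minimizing_form_min_coeffs:
  assumes "numerical_poly p" "degree p \<le> D"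
  shows "minimizing_form D (min_coeffs p) = p"
  using assms
proof (induction D arbitrary: p)
  case 0
  then obtain r where r: "p = [:r:]" by (auto elim: degree_eq_zeroE)
  with 0 obtain m where m: "r = of_int m"
    by (auto simp: numerical_poly_def elim: Ints_cases)
  have "min_coeffs p 0 = m"
    using 0 r m by (subst min_coeffs.simps) auto
  then show ?case
    by (simp add: minimizing_form_def r m binom_poly_def one_pCons)
next
  case (Suc D)
  show ?case
  proof (cases "degree p = Suc D")
    case False
    with Suc.prems have deg: "degree p \<le> D" by simp
    have "minimizing_form (Suc D) (min_coeffs p) = minimizing_form D (min_coeffs p)"
      using deg minimizing_form_Suc[of "min_coeffs p" D 0]
      by (simp add: min_coeffs_above_degree pcompose_idR)
    with Suc.IH[OF Suc.prems(1) deg] show ?thesis by simp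
  next
    case True
    define a where "a = standard_coeffs p (Suc D)"
    have a: "min_coeffs p (Suc D) = a"
      using min_coeffs_degree[of p] Suc.prems True by (simp add: a_def)
    have "minimizing_form D (min_coeffs p) = minimizing_form D (min_coeffs (min_step p))"
      using Suc.prems True by (intro minimizing_form_cong min_coeffs_below_degree) auto
    also have "\<dots> = min_step p"
      using Suc.prems True degree_min_step[of p]
      by (intro Suc.IH numerical_min_step) auto
    finally have v: "minimizing_form D (min_coeffs p) = min_step p" .
    have "int (Suc D) + 1 = int D + 2" "Suc D + 1 = D + 2" by simp_all
    then show ?thesis
      using minimizing_form_Suc[where b = "min_coeffs p", OF a] min_step_inverse[OF True a_def[symmetric]] v
      by (simp only:)
  qed
qed

theorem theorem3:
  fixes \<omega> :: "rat poly" and d :: nat and c :: "nat \<Rightarrow> int"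
  assumes "numerical_poly \<omega>" and "degree \<omega> = d"
    and "\<And>i. i \<in> {1..d+1} \<Longrightarrow> c i = (\<Sum>j=i-1..d. min_coeffs \<omega> j)"
  shows "\<omega> = binom_poly (int d + 1) (d + 1) - (\<Sum>i=0..d+1. binom_poly (int i - 1 - c i) i)"
proof -
  have "(\<Sum>i=0..d+1. binom_poly (int i - 1 - c i) i) =
      (\<Sum>i\<le>d+1. binom_poly (int i - 1 - (\<Sum>j=i-1..d. min_coeffs \<omega> j)) i)"
  proof (rule sum.cong)
    fix i assume "i \<in> {..d+1}"
    then show "binom_poly (int i - 1 - c i) i =
        binom_poly (int i - 1 - (\<Sum>j=i-1..d. min_coeffs \<omega> j)) i"
      using assms(3)[of i] by (cases "i = 0") auto
  qed (simp add: atMost_atLeast0)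
  with minimizing_form_min_coeffs[OF assms(1), of d] assms(2) show ?thesis
    by (simp add: minimizing_form_def)
qed

end
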